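(* For every finite simple graph $G$ on $n$ vertices with minimum degree $\delta(G)=5$, the domination number satisfies $\gamma(G) \le \frac{n}{3}$.
   Context: A set $D \subseteq V(G)$ is a dominating set of $G$ if every vertex of $G$ is in $D$ or adjacent to a vertex of $D$. The domination number $\gamma(G)$ is the minimum cardinality of a dominating set of $G$. $\delta(G)$ denotes the minimum vertex degree of $G$. *)

theory Defs
  imports Complex_Main "Graph_Theory.Pair_Digraph"
begin

text \<open>
  A finite simple graph is a \<^locale>\<open>pair_graph\<close>: a finite, loop-free digraph with a symmetric
  arc relation. An edge \<open>uv\<close> is represented by the two arcs \<open>(u, v)\<close> and \<open>(v, u)\<close>, so that the
  number of edges at \<open>v\<close> is the \<^const>\<open>out_degree\<close> of \<open>v\<close>.
\<close>

text \<open>Meaningful only for graphs with at least one vertex, as \<open>Min {}\<close> is unspecified.\<close>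

definition min_degree :: "'a pair_pre_digraph \<Rightarrow> nat" where
  "min_degree G = Min (out_degree (with_proj G) ` pverts G)"

definition dominating_set :: "'a pair_pre_digraph \<Rightarrow> 'a set \<Rightarrow> bool" where
  "dominating_set G D \<longleftrightarrow>
     D \<subseteq> pverts G \<and> (\<forall>v\<in>pverts G. v \<in> D \<or> (\<exists>u\<in>D. (u, v) \<in> parcs G))"

definition domination_number :: "'a pair_pre_digraph \<Rightarrow> nat" where
  "domination_number G = Min {card D | D. dominating_set G D}"

text \<open>The minimum is taken over a finite nonempty set, since the whole vertex set dominates.\<close>

lemma (in pair_graph) finite_dominating_set_cards: "finite {card D | D. dominating_set G D}"
proof -
  have "{card D | D. dominating_set G D} \<subseteq> card ` Pow (pverts G)"
    by (auto simp: dominating_set_def)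
  then show ?thesis
    using pair_finite_verts by (meson finite_Pow_iff finite_imageI finite_subset)
qed

lemma dominating_set_pverts: "dominating_set G (pverts G)"
  by (simp add: dominating_set_def)

end

(*
  Let W be the set of vertices that are not dominated yet, call its elements white and all other
  vertices blue. A white vertex gets weight 55 and a blue one a weight that depends only on its
  number of white neighbours. The total is 55 n at the start and 0 once everything is dominated, so
  it suffices to find, as long as W is not empty, a nonempty X <= W and a set A dominating X such
  that removing X from W lowers the weight by at least 165 |A|.

  Stars around vertices of large white degree have this property, until every white vertex has at
  most two and every blue vertex at most three white neighbours. A white vertex with two white
  neighbours then lies on a white path or cycle, where one or two new vertices do, except on a
  4-cycle: there it matters whether a blue neighbour of the cycle has a white neighbour elsewhere.
  What remains are isolated white vertices and white edges. There the weight of a blue vertex whose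
  only white neighbour lies on a white edge is lowered from 22 to 13, which makes it more profitable
  to separate such edges from the isolated vertices; again a suitable X always exists.
*)

theory Submission
  imports Defs
begin

text \<open>
  With white weight 55 and budget 165 per added vertex, the values solve the inequalities that the
  arguments below require. Tight are \<open>55 + 5 * 22 = 165\<close> (isolated white vertex, blue neighbours of
  white degree 1), \<open>30 + 3 * (55 - 22 + 3 * 4) = 165\<close> (blue vertex joining three white edges) and
  \<open>55 + 5 * (55 - 33) = 165\<close> (white vertex of white degree 5).
\<close>

definition blue_weight :: "nat \<Rightarrow> int" where
  "blue_weight j =
    (if j = 0 then 0 else if j = 1 then 22 else if j = 2 then 26 else if j = 3 then 30
     else if j = 4 then 33 else 36)"

lemma blue_weight_simps [simp]:
  "blue_weight 0 = 0" "blue_weight (Suc 0) = 22" "blue_weight 2 = 26"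
  "blue_weight 3 = 30" "blue_weight 4 = 33" "blue_weight 5 = 36"
  by (simp_all add: blue_weight_def)

lemma blue_weight_mono: "i \<le> j \<Longrightarrow> blue_weight i \<le> blue_weight j"
  by (auto simp: blue_weight_def)

lemma blue_weight_nonneg: "0 \<le> blue_weight j"
  by (simp add: blue_weight_def)

lemma blue_weight_le: "blue_weight j \<le> 36"
  by (simp add: blue_weight_def)

text \<open>The increments of \<open>blue_weight\<close> are 22, 4, 4, 3, 3. So a removed white
  neighbour is worth at least 4 as long as white degrees are at most three, and at least 3 up to
  degree five.\<close>

lemma blue_weight_diff_4:
  assumes "j \<le> 3" "i \<le> j"
  shows "4 * (int j - int i) \<le> blue_weight j - blue_weight i"
  using assms by (auto simp: blue_weight_def)

lemma blue_weight_diff_3: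
  assumes "j \<le> 5" "i \<le> j"
  shows "3 * (int j - int i) \<le> blue_weight j - blue_weight i"
  using assms by (auto simp: blue_weight_def)

section \<open>Covers, the potential and discharging along edges\<close>

locale min_degree_five =
  fixes V :: "'a set" and N :: "'a \<Rightarrow> 'a set"
  assumes finV: "finite V"
    and N_sub: "v \<in> V \<Longrightarrow> N v \<subseteq> V"
    and N_sym: "v \<in> V \<Longrightarrow> u \<in> N v \<Longrightarrow> v \<in> N u"
    and N_irrefl: "v \<notin> N v"
    and five_le_degree: "v \<in> V \<Longrightarrow> 5 \<le> card (N v)"
begin

abbreviation wdeg :: "'a set \<Rightarrow> 'a \<Rightarrow> nat" where
  "wdeg W v \<equiv> card (N v \<inter> W)"

definition covers :: "'a set \<Rightarrow> 'a set \<Rightarrow> bool" where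
  "covers A X \<longleftrightarrow> A \<subseteq> V \<and> (\<forall>x\<in>X. x \<in> A \<or> (\<exists>a\<in>A. x \<in> N a))"

text \<open>The weight \<open>c\<close> takes the white set as an argument, because blue weights
  change with it and because two weightings, \<open>wt\<close> and later \<open>sparse_wt\<close>,
  share this machinery.\<close>

definition potential :: "('a set \<Rightarrow> 'a \<Rightarrow> int) \<Rightarrow> 'a set \<Rightarrow> int" where
  "potential c W = 55 * int (card W) + (\<Sum>u\<in>V - W. c W u)"

definition reducible :: "('a set \<Rightarrow> 'a \<Rightarrow> int) \<Rightarrow> 'a set \<Rightarrow> 'a set \<Rightarrow> bool" where
  "reducible c W X \<longleftrightarrow> X \<noteq> {} \<and> X \<subseteq> W \<and>
     (\<exists>A. covers A X \<and> 165 * int (card A) \<le> potential c W - potential c (W - X))"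

lemma finN: "v \<in> V \<Longrightarrow> finite (N v)"
  using N_sub finV finite_subset by metis

lemma card_N_split:
  assumes "v \<in> V" shows "card (N v) = wdeg W v + card (N v - W)"
  using card_Int_Diff[OF finN[OF assms], of W] by simp

text \<open>Double counting of the edges between \<open>X\<close> and the blue vertices, each edge
  carrying the value of its end in \<open>X\<close>.\<close>

lemma sum_edges:
  fixes \<omega> :: "'a \<Rightarrow> int"
  assumes "X \<subseteq> W" "W \<subseteq> V"
  shows "(\<Sum>u\<in>V - W. \<Sum>x\<in>N u \<inter> X. \<omega> x) = (\<Sum>x\<in>X. \<omega> x * int (card (N x - W)))"
proof -
  have fX: "finite X" using assms finV finite_subset by metis
  have "(\<Sum>u\<in>V - W. \<Sum>x\<in>N u \<inter> X. \<omega> x)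
      = (\<Sum>u\<in>V - W. \<Sum>x\<in>{x. x \<in> X \<and> x \<in> N u}. \<omega> x)"
    by (intro sum.cong) auto
  also have "\<dots> = (\<Sum>x\<in>X. \<Sum>u\<in>{u. u \<in> V - W \<and> x \<in> N u}. \<omega> x)"
    by (rule sum.swap_restrict) (use fX finV in auto)
  also have "\<dots> = (\<Sum>x\<in>X. \<omega> x * int (card (N x - W)))"
  proof (intro sum.cong refl)
    fix x assume "x \<in> X"
    then have "{u. u \<in> V - W \<and> x \<in> N u} = N x - W"
      using assms N_sym N_sub by blast
    then show "(\<Sum>u\<in>{u. u \<in> V - W \<and> x \<in> N u}. \<omega> x) = \<omega> x * int (card (N x - W))"
      by simp
  qed
  finally show ?thesis .
qed

text \<open>A vertex of \<open>X\<close> turns blue and trades 55 for its new blue weight; the old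
  blue vertices contribute their own losses.\<close>

lemma potential_diff:
  assumes "X \<subseteq> W" "W \<subseteq> V"
  shows "potential c W - potential c (W - X)
    = (\<Sum>x\<in>X. 55 - c (W - X) x) + (\<Sum>u\<in>V - W. c W u - c (W - X) u)"
proof -
  have fW: "finite W" using assms finV finite_subset by metis
  have fX: "finite X" using assms fW finite_subset by metis
  have "V - (W - X) = (V - W) \<union> X" using assms by auto
  then have s: "(\<Sum>u\<in>V - (W - X). c (W - X) u)
      = (\<Sum>u\<in>V - W. c (W - X) u) + (\<Sum>x\<in>X. c (W - X) x)"
    using sum.union_disjoint[of "V - W" X "c (W - X)"] finV fX assms by auto
  have "card (W - X) = card W - card X" "card X \<le> card W"
    using assms fX fW by (auto simp: card_Diff_subset card_mono)
  then have "int (card (W - X)) = int (card W) - int (card X)" by simp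
  then show ?thesis
    unfolding potential_def s by (simp add: sum_subtractf algebra_simps)
qed

text \<open>Discharging: a blue vertex \<open>u\<close> sends \<open>\<omega> x\<close> of its loss
  to each neighbour \<open>x\<close> in \<open>X\<close> and keeps a surplus \<open>e u\<close>. The
  gain can then be read off at the vertices of \<open>X\<close>.\<close>

lemma gain_le_potential_diff:
  assumes "X \<subseteq> W" "W \<subseteq> V"
    and "\<And>u. u \<in> V - W \<Longrightarrow> (\<Sum>x\<in>N u \<inter> X. \<omega> x) + e u \<le> c W u - c (W - X) u"
  shows "(\<Sum>x\<in>X. 55 - c (W - X) x + \<omega> x * int (card (N x - W))) + (\<Sum>u\<in>V - W. e u)
    \<le> potential c W - potential c (W - X)"
proof -
  have "(\<Sum>u\<in>V - W. (\<Sum>x\<in>N u \<inter> X. \<omega> x) + e u) \<le> (\<Sum>u\<in>V - W. c W u - c (W - X) u)"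
    by (rule sum_mono) (use assms in auto)
  then show ?thesis
    using sum_edges[OF assms(1,2), of \<omega>] potential_diff[OF assms(1,2), of c]
    by (simp add: sum.distrib)
qed

lemma reducibleI:
  assumes W: "W \<subseteq> V" and X: "X \<noteq> {}" "X \<subseteq> W" and A: "covers A X"
    and drop: "\<And>u. u \<in> V - W \<Longrightarrow> (\<Sum>x\<in>N u \<inter> X. \<omega> x) + e u \<le> c W u - c (W - X) u"
    and lower: "\<And>x. x \<in> X \<Longrightarrow> g x \<le> 55 - c (W - X) x + \<omega> x * int (card (N x - W))"
    and le: "165 * int (card A) \<le> (\<Sum>x\<in>X. g x) + (\<Sum>u\<in>V - W. e u)"
  shows "reducible c W X"
proof -
  have "(\<Sum>x\<in>X. g x) \<le> (\<Sum>x\<in>X. 55 - c (W - X) x + \<omega> x * int (card (N x - W)))"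
    by (rule sum_mono) (rule lower)
  with gain_le_potential_diff[where c=c and e=e and \<omega>=\<omega>, OF X(2) W drop] le
  have "165 * int (card A) \<le> potential c W - potential c (W - X)"
    by linarith
  with X A show ?thesis unfolding reducible_def by blast
qed

section \<open>Stars around vertices of large white degree\<close>

definition wt :: "'a set \<Rightarrow> 'a \<Rightarrow> int" where
  "wt W u = blue_weight (wdeg W u)"

lemma wdeg_mono: "W' \<subseteq> W \<Longrightarrow> v \<in> V \<Longrightarrow> wdeg W' v \<le> wdeg W v"
  by (rule card_mono) (use finN in auto)

lemma wdeg_diff:
  assumes "X \<subseteq> W" "v \<in> V" shows "wdeg W v = wdeg (W - X) v + wdeg X v"
proof -
  have "N v \<inter> W = (N v \<inter> (W - X)) \<union> (N v \<inter> X)" using assms by auto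
  then show ?thesis using card_Un_disjoint[of "N v \<inter> (W - X)" "N v \<inter> X"] finN[OF assms(2)] by auto
qed

lemma wt_mono: "W' \<subseteq> W \<Longrightarrow> v \<in> V \<Longrightarrow> wt W' v \<le> wt W v"
  unfolding wt_def by (intro blue_weight_mono wdeg_mono)

text \<open>The uniform amount that a blue vertex can send along every edge to a removed vertex, for
  any choice of removed set.\<close>

definition slope :: "'a set \<Rightarrow> int \<Rightarrow> bool" where
  "slope W \<delta> \<longleftrightarrow> (\<forall>u\<in>V - W. \<forall>X\<subseteq>W. \<delta> * int (wdeg X u) \<le> wt W u - wt (W - X) u)"

lemma slope0: "slope W 0"
  unfolding slope_def using wt_mono by auto

lemma slope3: "(\<And>u. u \<in> V - W \<Longrightarrow> wdeg W u \<le> 5) \<Longrightarrow> slope W 3"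
  unfolding slope_def wt_def
  using blue_weight_diff_3 wdeg_diff by (smt (verit, best) Diff_iff le_add1 of_nat_add)

lemma slope4: "(\<And>u. u \<in> V - W \<Longrightarrow> wdeg W u \<le> 3) \<Longrightarrow> slope W 4"
  unfolding slope_def wt_def
  using blue_weight_diff_4 wdeg_diff by (smt (verit, best) Diff_iff le_add1 of_nat_add)

lemma reducible_wtI:
  assumes W: "W \<subseteq> V" and X: "X \<noteq> {}" "X \<subseteq> W" and A: "covers A X"
    and s: "slope W \<delta>" "0 \<le> \<delta>"
    and lower: "\<And>x. x \<in> X \<Longrightarrow> g x \<le> 55 - wt (W - X) x + \<delta> * int (card (N x - W))"
    and le: "165 * int (card A) \<le> (\<Sum>x\<in>X. g x)"
  shows "reducible wt W X"
proof (rule reducibleI[OF W X A, where \<omega>="\<lambda>_. \<delta>" and e="\<lambda>_. 0"])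
  fix u assume "u \<in> V - W"
  then show "(\<Sum>x\<in>N u \<inter> X. \<delta>) + 0 \<le> wt W u - wt (W - X) u"
    using s(1) X unfolding slope_def by (simp add: mult.commute)
qed (use lower le in auto)

text \<open>A blue vertex \<open>u\<close> that loses all its white neighbours drops to weight 0.
  What this exceeds the uniform \<open>\<delta>\<close> per edge by is credited as surplus at
  \<open>u\<close>.\<close>

lemma reducible_wt_centreI:
  assumes W: "W \<subseteq> V" and X: "X \<noteq> {}" "X \<subseteq> W" and A: "covers A X"
    and s: "slope W \<delta>" "0 \<le> \<delta>"
    and u: "u \<in> V - W" "N u \<inter> W \<subseteq> X"
    and lower: "\<And>x. x \<in> X \<Longrightarrow> g x \<le> 55 - wt (W - X) x + \<delta> * int (card (N x - W))"
    and le: "165 * int (card A) \<le> (\<Sum>x\<in>X. g x) + blue_weight (wdeg W u) - \<delta> * int (wdeg W u)"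
  shows "reducible wt W X"
proof (rule reducibleI[OF W X A, where \<omega>="\<lambda>_. \<delta>"
    and e="\<lambda>v. if v = u then blue_weight (wdeg W u) - \<delta> * int (wdeg W u) else 0"])
  fix v assume v: "v \<in> V - W"
  have "N u \<inter> X = N u \<inter> W" "N u \<inter> (W - X) = {}" using u(2) X by auto
  then show "(\<Sum>x\<in>N v \<inter> X. \<delta>) + (if v = u then blue_weight (wdeg W u) - \<delta> * int (wdeg W u) else 0)
      \<le> wt W v - wt (W - X) v"
    using s(1) X v unfolding slope_def by (auto simp: mult.commute wt_def)
next
  show "165 * int (card A) \<le> (\<Sum>x\<in>X. g x)
      + (\<Sum>v\<in>V - W. if v = u then blue_weight (wdeg W u) - \<delta> * int (wdeg W u) else 0)"
    using le u finV by simp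
qed (use lower in auto)

text \<open>Each covered vertex has at least \<open>5 - K\<close> blue neighbours. The factor is
  \<open>4 - K\<close> because the edge to \<open>u\<close> is not paid by \<open>\<delta>\<close>:
  the whole weight of \<open>u\<close> is counted separately.\<close>

lemma blue_star:
  assumes W: "W \<subseteq> V" and K: "\<And>w. w \<in> W \<Longrightarrow> wdeg W w \<le> K"
    and s: "slope W \<delta>" "0 \<le> \<delta>" and u: "u \<in> V - W" and j: "wdeg W u = j" "0 < j"
    and le: "165 \<le> int j * (55 - blue_weight K + \<delta> * (4 - int K)) + blue_weight j"
  shows "reducible wt W (N u \<inter> W)"
proof (rule reducible_wt_centreI[OF W _ _ _ s u, where A="{u}"
    and g="\<lambda>_. 55 - blue_weight K + \<delta> * (5 - int K)"])
  show "N u \<inter> W \<noteq> {}" using j by auto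
  show "covers {u} (N u \<inter> W)" using u by (auto simp: covers_def)
  fix x assume x: "x \<in> N u \<inter> W"
  then have xV: "x \<in> V" using W by auto
  have "wt (W - N u \<inter> W) x \<le> blue_weight K"
    using wt_mono[of "W - N u \<inter> W" W x] blue_weight_mono[OF K, of x] x xV unfolding wt_def
      by fastforce
  moreover have "5 - int K \<le> int (card (N x - W))"
    using five_le_degree[OF xV] card_N_split[OF xV, of W] K[of x] x by auto
  then have "\<delta> * (5 - int K) \<le> \<delta> * int (card (N x - W))"
    using s(2) by (rule mult_left_mono)
  ultimately show "55 - blue_weight K + \<delta> * (5 - int K)
      \<le> 55 - wt (W - N u \<inter> W) x + \<delta> * int (card (N x - W))"
    by linarith
next
  show "165 * int (card {u})
      \<le> (\<Sum>x\<in>N u \<inter> W. 55 - blue_weight K + \<delta> * (5 - int K)) + blue_weight (wdeg W u)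
      - \<delta> * int (wdeg W u)"
    using le j by (simp add: algebra_simps)
qed auto

text \<open>The centre keeps no white neighbour and each other vertex of the star loses the centre,
  so it keeps at most \<open>K - 1\<close>. Every vertex of the star has at least
  \<open>5 - K\<close> blue neighbours.\<close>

lemma white_star:
  assumes W: "W \<subseteq> V" and K: "\<And>w. w \<in> W \<Longrightarrow> wdeg W w \<le> K"
    and s: "slope W \<delta>" "0 \<le> \<delta>" and v: "v \<in> W" "wdeg W v = K"
    and le: "165 \<le> 55 + int K * (55 - blue_weight (K - 1)) + \<delta> * (5 - int K) * (int K + 1)"
  shows "reducible wt W (insert v (N v \<inter> W))"
proof (rule reducible_wtI[OF W _ _ _ s, where A="{v}"
    and g="\<lambda>x. 55 - (if x = v then 0 else blue_weight (K - 1)) + \<delta> * (5 - int K)"])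
  let ?X = "insert v (N v \<inter> W)"
  have vV: "v \<in> V" using v W by auto
  show "?X \<noteq> {}" "?X \<subseteq> W" using v by auto
  show "covers {v} ?X" using vV by (auto simp: covers_def)
  fix x assume x: "x \<in> ?X"
  then have xV: "x \<in> V" and xW: "x \<in> W" using v W by auto
  have "wt (W - ?X) x \<le> (if x = v then 0 else blue_weight (K - 1))"
  proof (cases "x = v")
    case True
    then have "N x \<inter> (W - ?X) = {}" by auto
    then show ?thesis using True by (simp add: wt_def)
  next
    case False
    then have "v \<in> N x" using x N_sym[OF vV] by auto
    then have "N x \<inter> {v} = {v}" by auto
    with wdeg_diff[of "{v}" W x] v xV have "wdeg W x = wdeg (W - {v}) x + 1" by simp
    moreover have "wdeg (W - ?X) x \<le> wdeg (W - {v}) x" by (rule wdeg_mono) (use xV in auto)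
    ultimately have "wdeg (W - ?X) x \<le> K - 1" using K[OF xW] by linarith
    then show ?thesis using False blue_weight_mono by (auto simp: wt_def)
  qed
  moreover have "5 - int K \<le> int (card (N x - W))"
    using five_le_degree[OF xV] card_N_split[OF xV, of W] K[OF xW] by auto
  then have "\<delta> * (5 - int K) \<le> \<delta> * int (card (N x - W))"
    using s(2) by (rule mult_left_mono)
  ultimately show "55 - (if x = v then 0 else blue_weight (K - 1)) + \<delta> * (5 - int K)
      \<le> 55 - wt (W - ?X) x + \<delta> * int (card (N x - W))"
    by linarith
next
  have vV: "v \<in> V" using v W by auto
  have "(\<Sum>x\<in>N v \<inter> W. 55 - (if x = v then 0 else blue_weight (K - 1)) + \<delta> * (5 - int K))
    = (\<Sum>x\<in>N v \<inter> W. 55 - blue_weight (K - 1) + \<delta> * (5 - int K))"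
    using N_irrefl by (intro sum.cong) auto
  then show "165 * int (card {v})
      \<le> (\<Sum>x\<in>insert v (N v \<inter> W). 55 - (if x = v then 0 else blue_weight (K - 1)) + \<delta> * (5 - int K))"
    using le v N_irrefl finN[OF vV] by (simp add: algebra_simps)
qed

text \<open>The blue weight never exceeds 36, so the losses of the new blue vertices alone suffice:
  55 + 6 * 19 = 169.\<close>

lemma big_white_star:
  assumes W: "W \<subseteq> V" and v: "v \<in> W" "6 \<le> wdeg W v"
  shows "reducible wt W (insert v (N v \<inter> W))"
proof (rule reducible_wtI[OF W _ _ _ slope0, where A="{v}"
    and g="\<lambda>x. 55 - (if x = v then 0 else 36)"])
  let ?X = "insert v (N v \<inter> W)"
  have vV: "v \<in> V" using v W by auto
  show "?X \<noteq> {}" "?X \<subseteq> W" using v by auto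
  show "covers {v} ?X" using vV by (auto simp: covers_def)
  have "N v \<inter> (W - ?X) = {}" by auto
  then show "55 - (if x = v then 0 else 36) \<le> 55 - wt (W - ?X) x + 0 * int (card (N x - W))" for x
    using blue_weight_le by (simp add: wt_def)
  have "(\<Sum>x\<in>N v \<inter> W. 55 - (if x = v then 0 else 36::int)) = (\<Sum>x\<in>N v \<inter> W. 19)"
    using N_irrefl by (intro sum.cong) auto
  then show "165 * int (card {v}) \<le> (\<Sum>x\<in>insert v (N v \<inter> W). 55 - (if x = v then 0 else 36))"
    using v N_irrefl finN[OF vV] by simp
qed auto

text \<open>White and blue degrees are bounded alternately: a smaller white degree makes the
  vertices of a star cheaper once they turn blue and gives them more blue neighbours, while a
  smaller blue degree makes slope 3 available.\<close>

lemma reducible_or_small: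
  assumes W: "W \<subseteq> V"
  shows "(\<exists>X. reducible wt W X) \<or> ((\<forall>w\<in>W. wdeg W w \<le> 2) \<and> (\<forall>u\<in>V - W. wdeg W u \<le> 3))"
proof (rule ccontr)
  assume "\<not> ?thesis"
  then have ns: "\<not> ((\<forall>w\<in>W. wdeg W w \<le> 2) \<and> (\<forall>u\<in>V - W. wdeg W u \<le> 3))"
    and nr: "\<not> reducible wt W X" for X by auto
  have "wdeg W w \<le> 5" if "w \<in> W" for w
    using big_white_star[OF W that] nr by force
  then have "wdeg W w \<le> 4" if "w \<in> W" for w
    using white_star[OF W _ slope0, of 5 w] nr that by force
  note K4 = this
  have "wdeg W u \<le> 5" if u: "u \<in> V - W" for u
  proof (rule ccontr)
    assume "\<not> ?thesis"
    then have j: "6 \<le> wdeg W u" by simp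
    then have "blue_weight (wdeg W u) = 36" by (simp add: blue_weight_def)
    then show False
      using blue_star[OF W K4 slope0 _ u refl] nr j by auto
  qed
  note J5 = this
  \<comment> \<open>From here on slope 3 holds. The gains of the four remaining stars are 170 (white
    degree 4), 176 (blue degree 5), 166 (white degree 3) and 173 (blue degree 4).\<close>
  have K3: "wdeg W w \<le> 3" if "w \<in> W" for w
    using white_star[OF W K4 slope3[OF J5], of w] K4[OF that] nr that by force
  have J4: "wdeg W u \<le> 4" if u: "u \<in> V - W" for u
    using blue_star[OF W K3 slope3[OF J5] _ u, of 5] J5[OF that] nr by force
  have K2: "wdeg W w \<le> 2" if "w \<in> W" for w
    using white_star[OF W K3 slope3[OF J5], of w] K3[OF that] nr that by force
  have J3: "wdeg W u \<le> 3" if u: "u \<in> V - W" for u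
    using blue_star[OF W K2 slope3[OF J5] _ u, of 4] J4[OF that] nr by force
  show False using ns K2 J3 by auto
qed


section \<open>White paths and cycles\<close>

text \<open>White degree at most 2 leaves at least three blue neighbours, and slope 4 makes them
  worth 12: hence 67 = 55 + 12 per removed vertex.\<close>

lemma reducible4I:
  assumes W: "W \<subseteq> V" and K: "\<And>w. w \<in> W \<Longrightarrow> wdeg W w \<le> 2" and s: "slope W 4"
    and X: "X \<noteq> {}" "X \<subseteq> W" and A: "covers A X"
    and le: "165 * int (card A) \<le> (\<Sum>x\<in>X. 67 - wt (W - X) x)"
  shows "reducible wt W X"
proof (rule reducible_wtI[OF W X A s _ _ le])
  fix x assume "x \<in> X"
  then have "x \<in> W" "x \<in> V" using X W by auto
  then have "3 \<le> card (N x - W)"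
    using five_le_degree[of x] card_N_split[of x W] K[of x] by linarith
  then show "67 - wt (W - X) x \<le> 55 - wt (W - X) x + 4 * int (card (N x - W))" by simp
qed simp

lemma wt_closed: "N x \<inter> W \<subseteq> X \<Longrightarrow> wt (W - X) x = 0"
proof -
  assume "N x \<inter> W \<subseteq> X"
  then have "N x \<inter> (W - X) = {}" by auto
  then show ?thesis by (simp add: wt_def)
qed

lemma wt_le_22: "wdeg W x \<le> 1 \<Longrightarrow> wt W x \<le> 22"
  using blue_weight_mono[of "wdeg W x" 1] by (simp add: wt_def)

lemma white_nbrs_eq:
  assumes "W \<subseteq> V" "x \<in> W" "wdeg W x \<le> 2" "{p, q} \<subseteq> N x \<inter> W" "p \<noteq> q"
  shows "N x \<inter> W = {p, q}"
proof -
  have "finite (N x \<inter> W)" using assms finN by blast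
  then show ?thesis using card_seteq[of "N x \<inter> W" "{p, q}"] assms by simp
qed

text \<open>The standing assumption for the refutations below: each of them exhibits a reducible
  set.\<close>

definition stuck :: "'a set \<Rightarrow> bool" where
  "stuck W \<longleftrightarrow> W \<subseteq> V \<and> (\<forall>w\<in>W. wdeg W w \<le> 2) \<and> (\<forall>u\<in>V - W. wdeg W u \<le> 3) \<and>
     (\<forall>X. \<not> reducible wt W X)"

lemma stuckD:
  assumes "stuck W"
  shows "W \<subseteq> V" "w \<in> W \<Longrightarrow> wdeg W w \<le> 2" "u \<in> V - W \<Longrightarrow> wdeg W u \<le> 3" "slope W 4"
    "\<not> reducible wt W X"
  using assms slope4 unfolding stuck_def by auto

text \<open>Otherwise \<open>v\<close> alone covers \<open>{v, a, b}\<close>, where only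
  \<open>b\<close> can keep a white neighbour, and at most one: the gain is 67 + 67 + 45 = 179. Thus
  a white path goes on, and triangles do not occur.\<close>

lemma next_vertex:
  assumes S: "stuck W"
    and v: "v \<in> W" "N v \<inter> W = {a, b}" "a \<noteq> b"
  obtains a' where "N a \<inter> W = {v, a'}" "a' \<in> W" "a' \<noteq> v" "a' \<noteq> a" "a' \<noteq> b"
proof -
  note W = stuckD(1)[OF S] and K = stuckD(2)[OF S] and s = stuckD(4)[OF S] and nr = stuckD(5)[OF S]
  let ?X = "{v, a, b}"
  have ab: "a \<in> W" "b \<in> W" "v \<noteq> a" "v \<noteq> b" using v N_irrefl by auto
  have va: "v \<in> N a" "v \<in> N b" using v W N_sym by blast+
  have "\<exists>a'. a' \<in> N a \<inter> (W - ?X)"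
  proof (rule ccontr)
    assume "\<nexists>a'. a' \<in> N a \<inter> (W - ?X)"
    then have a0: "wt (W - ?X) a = 0" by (intro wt_closed) auto
    have v0: "wt (W - ?X) v = 0" using v by (intro wt_closed) auto
    have bV: "b \<in> V" using ab W by auto
    have "N b \<inter> {v} = {v}" using va by auto
    then have "wdeg W b = wdeg (W - {v}) b + 1" using wdeg_diff[of "{v}" W b] v bV by simp
    moreover have "wdeg (W - ?X) b \<le> wdeg (W - {v}) b" using bV by (intro wdeg_mono) auto
    ultimately have "wt (W - ?X) b \<le> 22" using K[OF ab(2)] by (intro wt_le_22) linarith
    then have "165 * int (card {v}) \<le> (\<Sum>x\<in>?X. 67 - wt (W - ?X) x)"
      using a0 v0 ab v(3) by simp
    moreover have "covers {v} ?X" using v W by (auto simp: covers_def)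
    ultimately have "reducible wt W ?X"
      using reducible4I[OF W K s, of ?X "{v}"] v ab by auto
    then show False using nr by simp
  qed
  then obtain a' where a': "a' \<in> N a" "a' \<in> W" "a' \<notin> ?X" by auto
  have "N a \<inter> W = {v, a'}"
    by (rule white_nbrs_eq[OF W ab(1) K[OF ab(1)]]) (use a' va v in auto)
  then show thesis using that a' by auto
qed

text \<open>The cycle is v-a-w-b, with \<open>v\<close> opposite \<open>w\<close>. Since all white
  neighbours are listed, it is a whole component of the graph induced on \<open>W\<close>.\<close>

definition four_cycle :: "'a set \<Rightarrow> 'a \<Rightarrow> 'a \<Rightarrow> 'a \<Rightarrow> 'a \<Rightarrow> bool" where
  "four_cycle W v a w b \<longleftrightarrow> distinct [v, a, w, b] \<and> N v \<inter> W = {a, b} \<and> N a \<inter> W = {v, w}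
     \<and> N w \<inter> W = {a, b} \<and> N b \<inter> W = {v, w} \<and> {v, a, w, b} \<subseteq> W"

lemma four_cycle_rotate: "four_cycle W v a w b \<Longrightarrow> four_cycle W a w b v"
  unfolding four_cycle_def by (auto simp: insert_commute)

text \<open>The white path through \<open>v\<close> is followed in both directions. If the vertices
  at distance two do not coincide, there is a 5-cycle or a six-vertex path, and two vertices pay for
  either.\<close>

lemma two_regular_imp_four_cycle:
  assumes S: "stuck W"
    and v: "v \<in> W" "wdeg W v = 2"
  obtains a w b where "four_cycle W v a w b"
proof -
  note W = stuckD(1)[OF S] and K = stuckD(2)[OF S] and s = stuckD(4)[OF S] and nr = stuckD(5)[OF S]
  note nxt = next_vertex[OF S]
  obtain a b where ab: "N v \<inter> W = {a, b}" "a \<noteq> b"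
    using v(2) by (auto simp: card_2_iff)
  have ba: "N v \<inter> W = {b, a}" using ab by auto
  have abW: "a \<in> W" "b \<in> W" "v \<noteq> a" "v \<noteq> b" using ab N_irrefl by auto
  obtain a' where a': "N a \<inter> W = {v, a'}" "a' \<in> W" "a' \<noteq> v" "a' \<noteq> a" "a' \<noteq> b"
    using nxt[OF v(1) ab] .
  obtain b' where b': "N b \<inter> W = {v, b'}" "b' \<in> W" "b' \<noteq> v" "b' \<noteq> b" "b' \<noteq> a"
    using nxt[OF v(1) ba] ab(2) by metis
  show thesis
  proof (cases "a' = b'")
    case True
    have "a \<in> N a'" "b \<in> N a'" using a' b' True abW W N_sym by blast+
    then have "N a' \<inter> W = {a, b}"
      using white_nbrs_eq[OF W a'(2) K[OF a'(2)], of a b] abW ab(2) by auto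
    then show thesis using that[of a a' b] True a' b' ab abW v by (auto simp: four_cycle_def)
  next
    case False
    have "N a \<inter> W = {a', v}" "N b \<inter> W = {b', v}" using a' b' by auto
    note eqs = this
    obtain a'' where a'': "N a' \<inter> W = {a, a''}" "a'' \<in> W" "a'' \<noteq> a" "a'' \<noteq> a'" "a'' \<noteq> v"
      using nxt[OF abW(1) eqs(1) a'(3)] .
    obtain b'' where b'': "N b' \<inter> W = {b, b''}" "b'' \<in> W" "b'' \<noteq> b" "b'' \<noteq> b'" "b'' \<noteq> v"
      using nxt[OF abW(2) eqs(2) b'(3)] .
    have False
    proof (cases "a'' = b'")
      case True
      \<comment> \<open>A white 5-cycle: 5 * 67 = 335 against a budget of 330.\<close>
      let ?X = "{v, a, b, a', b'}"
      have "b' \<in> N a'" using a'' True by auto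
      then have "a' \<in> N b' \<inter> W" using a'(2) W N_sym by blast
      then have "b'' = a'" using b'' a' by auto
      then have "wt (W - ?X) x = 0" if "x \<in> ?X" for x
        using that ab a' b' a'' b'' True by (intro wt_closed) auto
      then have "(\<Sum>x\<in>?X. 67 - wt (W - ?X) x) = (\<Sum>x\<in>?X. 67)" by (intro sum.cong) auto
      also have "\<dots> = 335" using abW ab(2) a' b' False by auto
      moreover have "card {v, a'} = 2" using a' by auto
      moreover have "covers {v, a'} ?X"
        using v a' W ab \<open>b' \<in> N a'\<close> by (auto simp: covers_def)
      ultimately have "reducible wt W ?X"
        using reducible4I[OF W K s, of ?X "{v, a'}"] v(1) abW a'(2) b'(2) by auto
      then show False using nr by simp
    next
      case False
      \<comment> \<open>Six consecutive vertices, covered by \<open>a\<close> and \<open>b'\<close>.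
        Only the ends \<open>a'\<close> and \<open>b''\<close> can keep a white neighbour, at most
        one each: 6 * 67 - 2 * 22 = 358.\<close>
      let ?X = "{a', a, v, b, b', b''}"
      have "b'' \<noteq> a'"
      proof
        assume "b'' = a'"
        then have "a' \<in> N b'" using b'' by auto
        then have "b' \<in> N a' \<inter> W" using b'(2) W N_sym by blast
        then show False using a'' b' False by auto
      qed
      moreover have "b'' \<noteq> a"
      proof
        assume "b'' = a"
        then have "a \<in> N b'" using b'' by auto
        then have "b' \<in> N a \<inter> W" using b'(2) W N_sym by blast
        then show False using a' b' \<open>a' \<noteq> b'\<close> by auto
      qed
      ultimately have card6: "distinct [a', a, v, b, b', b'']"
        using abW ab(2) a' b' a'' b'' \<open>a' \<noteq> b'\<close> by auto
      have cl: "wt (W - ?X) x = 0" if "x \<in> {a, v, b, b'}" for x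
        using that ab a' b' a'' b'' by (intro wt_closed) auto
      have "wt (W - ?X) a' \<le> 22"
      proof (rule wt_le_22)
        have "N a' \<inter> (W - ?X) \<subseteq> {a''}" using a'' by auto
        then show "wdeg (W - ?X) a' \<le> 1" using card_mono[of "{a''}"] by fastforce
      qed
      moreover have "wt (W - ?X) b'' \<le> 22"
      proof (rule wt_le_22)
        have V: "b'' \<in> V" using b''(2) W by auto
        have "b'' \<in> N b'" using b'' by auto
        then have "N b'' \<inter> {b'} = {b'}" using b'(2) W N_sym by blast
        then have "wdeg W b'' = wdeg (W - {b'}) b'' + 1" using wdeg_diff[of "{b'}" W b''] b' V
          by simp
        moreover have "wdeg (W - ?X) b'' \<le> wdeg (W - {b'}) b''" using V by (intro wdeg_mono) auto
        ultimately show "wdeg (W - ?X) b'' \<le> 1" using K[OF b''(2)] by linarith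
      qed
      moreover have "(\<Sum>x\<in>?X. 67 - wt (W - ?X) x)
        = 402 - wt (W - ?X) a' - wt (W - ?X) b''"
        using card6 cl by simp
      moreover have "card {a, b'} = 2" using b' by auto
      moreover have "covers {a, b'} ?X"
        using a' b' b'' abW W by (auto simp: covers_def)
      ultimately have "reducible wt W ?X"
        using reducible4I[OF W K s, of ?X "{a, b'}"] v(1) abW a'(2) b'(2) b''(2) by auto
      then show False using nr by simp
    qed
    then show thesis ..
  qed
qed

text \<open>The vertex would lie on a white 4-cycle. It needs two covering vertices, but slope 4
  yields only 4 * 67 = 268 of the 330. The rest comes from its blue neighbours: either all of them
  lose their whole weight, or one of them also covers white vertices elsewhere.\<close>

lemma white_degree_le_1:
  assumes S: "stuck W"
    and v: "v \<in> W"
  shows "wdeg W v \<le> 1"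
proof (rule ccontr)
  note W = stuckD(1)[OF S] and K = stuckD(2)[OF S] and s = stuckD(4)[OF S] and nr = stuckD(5)[OF S]
  note J = stuckD(3)[OF S] and fc = two_regular_imp_four_cycle[OF S]
  assume "\<not> wdeg W v \<le> 1"
  then have "wdeg W v = 2" using K[OF v] by simp
  then obtain a w b where c: "four_cycle W v a w b" using fc v by blast
  let ?Q = "{v, a, w, b}"
  have QW: "?Q \<subseteq> W" and cardQ: "card ?Q = 4" and clQ: "x \<in> ?Q \<Longrightarrow> N x \<inter> W \<subseteq> ?Q" for x
    using c unfolding four_cycle_def by auto
  show False
  proof (cases "\<forall>u\<in>V - W. N u \<inter> ?Q \<noteq> {} \<longrightarrow> N u \<inter> W \<subseteq> ?Q")
    case True
    \<comment> \<open>All blue neighbours of the cycle drop to 0, and \<open>blue_weight j\<close>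
      is at least 10 * j for \<open>j\<close> up to 3. So each edge is worth 10, and the gain is 4 *
      (55 + 3 * 10) = 340.\<close>
    have "reducible wt W ?Q"
    proof (rule reducibleI[OF W _ QW, where A="{v, w}" and \<omega>="\<lambda>_. 10" and e="\<lambda>_. 0" and g="\<lambda>_. 85"])
      have "a \<in> N v" "b \<in> N v" "v \<in> V" "w \<in> V" using c W unfolding four_cycle_def by auto
      then show "covers {v, w} ?Q" by (auto simp: covers_def)
      show "165 * int (card {v, w}) \<le> (\<Sum>x\<in>?Q. 85) + (\<Sum>u\<in>V - W. 0)"
        using c unfolding four_cycle_def by simp
    next
      fix u assume u: "u \<in> V - W"
      show "(\<Sum>x\<in>N u \<inter> ?Q. 10) + 0 \<le> wt W u - wt (W - ?Q) u"
      proof (cases "N u \<inter> ?Q = {}")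
        case True
        then show ?thesis using wt_mono[of "W - ?Q" W u] u by simp
      next
        case False
        then have sub: "N u \<inter> W \<subseteq> ?Q" using True u by blast
        then have "N u \<inter> ?Q = N u \<inter> W" using QW by blast
        moreover have "10 * int (wdeg W u) \<le> blue_weight (wdeg W u)" using J[OF u]
          by (auto simp: blue_weight_def)
        ultimately show ?thesis using wt_closed[OF sub] by (simp add: wt_def)
      qed
    next
      fix x assume x: "x \<in> ?Q"
      then have "x \<in> W" "x \<in> V" using QW W by auto
      then have "3 \<le> card (N x - W)" using five_le_degree[of x] card_N_split[of x W] K[of x]
        by linarith
      then show "85 \<le> 55 - wt (W - ?Q) x + 10 * int (card (N x - W))"
        using wt_closed[OF clQ[OF x]] by simp
    qed auto
    then show False using nr by simp
  next
    case False
    then obtain u x y where u: "u \<in> V - W" and x: "x \<in> N u" "x \<in> ?Q"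
      and y: "y \<in> N u" "y \<in> W" "y \<notin> ?Q" by blast
    \<comment> \<open>Rotating the cycle puts \<open>x\<close> first: \<open>u\<close> covers
      \<open>x\<close>, and the opposite vertex \<open>w1\<close> covers the other three.\<close>
    obtain a1 w1 b1 where c1: "four_cycle W x a1 w1 b1" "{x, a1, w1, b1} = ?Q"
    proof -
      note r = four_cycle_rotate
      consider "x = v" | "x = a" | "x = w" | "x = b" using x by auto
      then show thesis
      proof cases
        case 1 then show ?thesis using that c by blast
      next
        case 2 then show ?thesis using that[OF r[OF c, folded 2]] by auto
      next
        case 3 then show ?thesis using that[OF r[OF r[OF c], folded 3]] by auto
      next
        case 4 then show ?thesis using that[OF r[OF r[OF r[OF c]], folded 4]] by auto
      qed
    qed
    have w1: "w1 \<in> V" "a1 \<in> N w1" "b1 \<in> N w1"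
      using c1 W unfolding four_cycle_def by auto
    show False
    proof (cases "\<exists>y\<in>N u \<inter> W - ?Q. wdeg W y = 2")
      case True
      then obtain z where z: "z \<in> N u" "z \<in> W" "z \<notin> ?Q" "wdeg W z = 2" by auto
      obtain a2 w2 b2 where c2: "four_cycle W z a2 w2 b2" using fc[OF z(2,4)] .
      let ?R = "{z, a2, w2, b2}"
      have RW: "?R \<subseteq> W" and cardR: "card ?R = 4" and clR: "x \<in> ?R \<Longrightarrow> N x \<inter> W \<subseteq> ?R" for x
        using c2 unfolding four_cycle_def by auto
      have sym: "q \<in> ?Q" if "p \<in> ?Q" "p \<in> N q" "q \<in> W" for p q
      proof -
        have "q \<in> N p" using that W N_sym by blast
        then show ?thesis using clQ[OF that(1)] that(3) by blast
      qed
      have n: "a2 \<in> N z" "b2 \<in> N z" "a2 \<in> N w2" "w2 \<in> N a2" "a2 \<in> W" "w2 \<in> W"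
        using c2 unfolding four_cycle_def by auto
      have a2: "a2 \<notin> ?Q" using sym n z by blast
      moreover have "b2 \<notin> ?Q" using sym n z by blast
      moreover have "w2 \<notin> ?Q" using sym n a2 by blast
      ultimately have disj: "?Q \<inter> ?R = {}" using z by blast
      have w2: "w2 \<in> V" "a2 \<in> N w2" "b2 \<in> N w2"
        using c2 W unfolding four_cycle_def by auto
      \<comment> \<open>Two disjoint 4-cycles linked by \<open>u\<close>: three vertices cover
        eight, and 8 * 67 = 536 exceeds 495.\<close>
      let ?X = "?Q \<union> ?R"
      have "card ?X = 8" using card_Un_disjoint[OF _ _ disj] cardQ cardR by simp
      moreover have "wt (W - ?X) x = 0" if "x \<in> ?X" for x
        using that clQ clR by (intro wt_closed) blast
      then have "(\<Sum>x\<in>?X. 67 - wt (W - ?X) x) = (\<Sum>x\<in>?X. 67)" by (intro sum.cong) auto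
      ultimately have "(\<Sum>x\<in>?X. 67 - wt (W - ?X) x) = 536" by (simp only: sum_constant)
      moreover have "card {u, w1, w2} \<le> 3" by (simp add: card_insert_if)
      moreover have "covers {u, w1, w2} ?X"
        using u x z w1 w2 unfolding c1(2)[symmetric] by (auto simp: covers_def)
      ultimately have "reducible wt W ?X"
        using reducible4I[OF W K s, of ?X "{u, w1, w2}"] QW RW by auto
      then show False using nr by simp
    next
      case False
      let ?Y = "N u \<inter> W - ?Q"
      let ?X = "?Q \<union> ?Y"
      have fY: "finite ?Y" using u finN by blast
      have "y \<in> ?Y" using y by auto
      then have cY: "1 \<le> card ?Y" using fY by (metis One_nat_def Suc_leI card_gt_0_iff empty_iff)
      have "2 \<le> wdeg W u"
      proof -
        have "{x, y} \<subseteq> N u \<inter> W" "x \<noteq> y" using x y QW by auto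
        then show ?thesis using card_mono[of "N u \<inter> W" "{x, y}"] finN u by auto
      qed
      \<comment> \<open>The surplus at \<open>u\<close> is 26 - 8 or 30 - 12.\<close>
      then have b18: "blue_weight (wdeg W u) - 4 * int (wdeg W u) = 18" using J[OF u]
        by (auto simp: blue_weight_def)
      \<comment> \<open>A vertex outside the cycle has white degree at most 1, so it gains at least
        55 - 22 + 4 * 4 = 49. With the surplus at \<open>u\<close> the total is at least 268 + 49 +
        18 = 335.\<close>
      have "reducible wt W ?X"
      proof (rule reducible_wt_centreI[OF W _ _ _ s _ u, where A="{u, w1}"
          and g="\<lambda>p. if p \<in> ?Q then 67 else 49"])
        show "covers {u, w1} ?X"
          using u x w1 unfolding c1(2)[symmetric] by (auto simp: covers_def)
        have "(\<Sum>p\<in>?X. if p \<in> ?Q then 67 else 49::int)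
          = (\<Sum>p\<in>?Q. if p \<in> ?Q then 67 else 49) + (\<Sum>p\<in>?Y. if p \<in> ?Q then 67 else 49)"
          by (rule sum.union_disjoint) (use fY in auto)
        also have "(\<Sum>p\<in>?Q. if p \<in> ?Q then 67 else 49::int) = (\<Sum>p\<in>?Q. 67)"
          by (rule sum.cong) auto
        also have "\<dots> = 268" by (simp only: sum_constant cardQ)
        also have "(\<Sum>p\<in>?Y. if p \<in> ?Q then 67 else 49::int) = (\<Sum>p\<in>?Y. 49)"
          by (rule sum.cong) auto
        finally have "(\<Sum>p\<in>?X. if p \<in> ?Q then 67 else 49::int) = 268 + 49 * int (card ?Y)"
          by (simp only: sum_constant mult.commute)
        moreover have "card {u, w1} \<le> 2" by (simp add: card_insert_if)
        ultimately show "165 * int (card {u, w1}) \<le>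
            (\<Sum>p\<in>?X. if p \<in> ?Q then 67 else 49) + blue_weight (wdeg W u) - 4 * int (wdeg W u)"
          using b18 cY by linarith
      next
        fix p assume p: "p \<in> ?X"
        then have pW: "p \<in> W" "p \<in> V" using QW W by auto
        show "(if p \<in> ?Q then 67 else 49) \<le> 55 - wt (W - ?X) p + 4 * int (card (N p - W))"
        proof (cases "p \<in> ?Q")
          case True
          then have "wt (W - ?X) p = 0" using clQ[OF True] by (intro wt_closed) blast
          moreover have "3 \<le> card (N p - W)"
            using five_le_degree[of p] card_N_split[of p W] K[of p] pW by linarith
          ultimately show ?thesis using True by simp
        next
          case Fp: False
          then have "wdeg W p \<le> 1" using p False K[OF pW(1)] by force
          moreover from this have "wt (W - ?X) p \<le> 22"
            using wt_le_22 wt_mono[of "W - ?X" W p] pW by (meson Diff_subset order_trans)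
          moreover have "4 \<le> card (N p - W)"
            using five_le_degree[of p] card_N_split[of p W] \<open>wdeg W p \<le> 1\<close> pW by linarith
          ultimately show ?thesis using Fp by simp
        qed
      qed (use QW in auto)
      then show False using nr by simp
    qed
  qed
qed

text \<open>Once white degrees are at most 1, the star of a blue vertex with three white neighbours
  pays exactly 165.\<close>

lemma reducible_or_sparse:
  assumes W: "W \<subseteq> V"
  shows "(\<exists>X. reducible wt W X) \<or> ((\<forall>w\<in>W. wdeg W w \<le> 1) \<and> (\<forall>u\<in>V - W. wdeg W u \<le> 2))"
proof (cases "\<exists>X. reducible wt W X")
  case False
  then have nr: "\<not> reducible wt W X" for X by simp
  have K2: "wdeg W w \<le> 2" if "w \<in> W" for w using reducible_or_small[OF W] False that by auto
  have J3: "wdeg W w \<le> 3" if "w \<in> V - W" for w using reducible_or_small[OF W] False that by auto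
  have "stuck W" using W K2 J3 nr unfolding stuck_def by blast
  then have K1: "wdeg W w \<le> 1" if "w \<in> W" for w
    using white_degree_le_1 that by blast
  have "wdeg W u \<le> 2" if u: "u \<in> V - W" for u
    using blue_star[OF W K1 slope4[OF J3] _ u, of 3] J3[OF that] nr by force
  then show ?thesis using K1 by blast
qed simp


section \<open>Isolated white vertices and white edges\<close>

text \<open>13 is half of 26. When whole white components are removed, a blue vertex then loses at
  least 13 per removed neighbour, unless an isolated white vertex remains next to it.\<close>

definition sparse_wt :: "'a set \<Rightarrow> 'a \<Rightarrow> int" where
  "sparse_wt W u =
    (if wdeg W u = 1 \<and> (\<exists>x\<in>N u \<inter> W. N x \<inter> W \<noteq> {}) then 13 else blue_weight (wdeg W u))"

definition sparse :: "'a set \<Rightarrow> bool" where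
  "sparse W \<longleftrightarrow> W \<subseteq> V \<and> (\<forall>w\<in>W. wdeg W w \<le> 1) \<and> (\<forall>u\<in>V - W. wdeg W u \<le> 2)"

text \<open>A union of components of the graph induced on \<open>W\<close>. Removing it leaves the
  white neighbourhoods of the other white vertices intact, so these stay isolated or paired.\<close>

definition closed_in :: "'a set \<Rightarrow> 'a set \<Rightarrow> bool" where
  "closed_in W X \<longleftrightarrow> X \<subseteq> W \<and> (\<forall>x\<in>X. N x \<inter> W \<subseteq> X)"

lemma closed_inD:
  assumes "closed_in W X" "W \<subseteq> V"
  shows "w \<in> W - X \<Longrightarrow> N w \<inter> (W - X) = N w \<inter> W"
  using assms N_sym unfolding closed_in_def by blast

lemma sparse_diff:
  assumes "sparse W" "closed_in W X"
  shows "sparse (W - X)"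
proof -
  have W: "W \<subseteq> V" using assms unfolding sparse_def by auto
  have "wdeg (W - X) w \<le> 1" if "w \<in> W - X" for w
    using assms that closed_inD[OF assms(2) W that] unfolding sparse_def by auto
  moreover have "wdeg (W - X) u \<le> 2" if "u \<in> V - (W - X)" for u
  proof (cases "u \<in> X")
    case True
    then have "N u \<inter> (W - X) = {}" using assms(2) unfolding closed_in_def by auto
    then show ?thesis by simp
  next
    case False
    then have "wdeg W u \<le> 2" using assms that unfolding sparse_def by auto
    then show ?thesis using wdeg_mono[of "W - X" W u] that by fastforce
  qed
  ultimately show ?thesis using W unfolding sparse_def by blast
qed

lemma sparse_wt_cases:
  assumes "sparse W" "u \<in> V - W"
  obtains (0) "N u \<inter> W = {}" "sparse_wt W u = 0"
    | (isolated) x where "N u \<inter> W = {x}" "N x \<inter> W = {}" "sparse_wt W u = 22"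
    | (paired) x where "N u \<inter> W = {x}" "N x \<inter> W \<noteq> {}" "sparse_wt W u = 13"
    | (2) x y where "N u \<inter> W = {x, y}" "x \<noteq> y" "sparse_wt W u = 26"
proof -
  have "wdeg W u \<le> 2" using assms unfolding sparse_def by auto
  then consider "wdeg W u = 0" | "wdeg W u = 1" | "wdeg W u = 2" by linarith
  then show thesis
  proof cases
    case 1
    then have "N u \<inter> W = {}" using finN assms by auto
    then show ?thesis using that(1) by (simp add: sparse_wt_def)
  next
    case 2
    then obtain x where "N u \<inter> W = {x}" by (auto simp: card_1_singleton_iff)
    then show ?thesis using that(2,3) by (cases "N x \<inter> W = {}") (auto simp: sparse_wt_def)
  next
    case 3
    then obtain x y where xy: "N u \<inter> W = {x, y}" "x \<noteq> y" by (auto simp: card_2_iff)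
    have "sparse_wt W u = 26" unfolding sparse_wt_def 3 by simp
    then show ?thesis using that(4) xy by blast
  qed
qed

text \<open>The critical case is \<open>isolated\<close>: there the loss is only 26 - 22 = 4. The
  arguments below have to show at which removed vertices it cannot occur.\<close>

lemma sparse_wt_drop_cases:
  assumes S: "sparse W" and X: "closed_in W X" and u: "u \<in> V - W"
  obtains (0) "N u \<inter> X = {}" "sparse_wt W u - sparse_wt (W - X) u = 0"
    | (1) "wdeg X u = 1" "N u \<inter> W = N u \<inter> X" "13 \<le> sparse_wt W u - sparse_wt (W - X) u"
    | (2) "wdeg X u = 2" "N u \<inter> W = N u \<inter> X" "sparse_wt W u - sparse_wt (W - X) u = 26"
    | (isolated) x where "wdeg X u = 1" "x \<in> N u \<inter> (W - X)" "N x \<inter> W = {}"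
        "sparse_wt W u - sparse_wt (W - X) u = 4"
    | (paired) x where "wdeg X u = 1" "x \<in> N u \<inter> (W - X)" "N x \<inter> W \<noteq> {}"
        "sparse_wt W u - sparse_wt (W - X) u = 13"
proof -
  have W: "W \<subseteq> V" using S unfolding sparse_def by auto
  have XW: "X \<subseteq> W" using X unfolding closed_in_def by auto
  show thesis
  proof (cases "N u \<inter> X = {}")
    case True
    then have eq: "N u \<inter> (W - X) = N u \<inter> W" by auto
    moreover have "N x \<inter> (W - X) = N x \<inter> W" if "x \<in> N u \<inter> W" for x
      using closed_inD[OF X W, of x] that True by blast
    ultimately have "(\<exists>x\<in>N u \<inter> (W - X). N x \<inter> (W - X) \<noteq> {}) = (\<exists>x\<in>N u \<inter> W. N x \<inter> W \<noteq> {})"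
      by (simp only: eq) simp
    then have "sparse_wt (W - X) u = sparse_wt W u" by (simp only: sparse_wt_def eq)
    then show ?thesis using that(1) True by simp
  next
    case F: False
    show ?thesis
    proof (cases "N u \<inter> W \<subseteq> X")
      case True
      then have eq: "N u \<inter> (W - X) = {}" "N u \<inter> W = N u \<inter> X" using XW by auto
      then have z: "sparse_wt (W - X) u = 0" by (simp add: sparse_wt_def)
      show ?thesis
        using S u
      proof (cases rule: sparse_wt_cases)
        case 0 then show ?thesis using F eq by auto
      next
        case (isolated x) then show ?thesis using that(2) eq z by auto
      next
        case (paired x) then show ?thesis using that(2) eq z by auto
      next
        case (2 x y) then show ?thesis using that(3) eq z by auto
      qed
    next
      case False
      show ?thesis
        using S u
      proof (cases rule: sparse_wt_cases)
        case 0 then show ?thesis using F XW by auto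
      next
        case (isolated x) then show ?thesis using False F XW by auto
      next
        case (paired x) then show ?thesis using False F XW by auto
      next
        case (2 x y)
        obtain p where p: "p \<in> N u" "p \<in> X" using F by blast
        obtain q where q: "q \<in> N u \<inter> W" "q \<notin> X" using False by blast
        have "p \<in> {x, y}" "q \<in> {x, y}" "p \<noteq> q" using p q XW 2(1) by blast+
        then have pq: "N u \<inter> W = {p, q}" "p \<noteq> q" "p \<in> X" "q \<notin> X"
          using 2(1) p q by auto
        then have "N u \<inter> X = {p}" "N u \<inter> (W - X) = {q}" using XW by auto
        moreover have "N q \<inter> (W - X) = N q \<inter> W"
          using closed_inD[OF X W, of q] pq by blast
        ultimately show ?thesis
          using that(4,5)[of q] 2 by (cases "N q \<inter> W = {}") (auto simp: sparse_wt_def)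
      qed
    qed
  qed
qed

text \<open>Removed vertices get weight 0 because \<open>X\<close> is closed. As
  \<open>\<omega> x\<close> is nonnegative, the number of blue neighbours may be replaced by its
  lower bound.\<close>

lemma reducible_sparse_wtI:
  assumes S: "sparse W" and X: "X \<noteq> {}" "closed_in W X" and A: "covers A X"
    and drop: "\<And>u. u \<in> V - W \<Longrightarrow> (\<Sum>x\<in>N u \<inter> X. \<omega> x) + e u \<le> sparse_wt W u - sparse_wt (W - X) u"
    and nonneg: "\<And>x. x \<in> X \<Longrightarrow> 0 \<le> \<omega> x"
    and le: "165 * int (card A) \<le> (\<Sum>x\<in>X. 55 + \<omega> x * (5 - int (wdeg W x))) + (\<Sum>u\<in>V - W. e u)"
  shows "reducible sparse_wt W X"
proof (rule reducibleI[OF _ X(1) _ A drop _ le])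
  show W: "W \<subseteq> V" and XW: "X \<subseteq> W" using S X unfolding sparse_def closed_in_def by auto
  fix x assume x: "x \<in> X"
  then have "N x \<inter> (W - X) = {}" using X unfolding closed_in_def by auto
  then have "sparse_wt (W - X) x = 0" by (simp add: sparse_wt_def)
  moreover have "x \<in> V" using x W XW by auto
  then have "5 - int (wdeg W x) \<le> int (card (N x - W))"
    using five_le_degree[of x] card_N_split[of x W] by linarith
  then have "\<omega> x * (5 - int (wdeg W x)) \<le> \<omega> x * int (card (N x - W))"
    using nonneg[OF x] by (rule mult_left_mono)
  ultimately show "55 + \<omega> x * (5 - int (wdeg W x))
      \<le> 55 - sparse_wt (W - X) x + \<omega> x * int (card (N x - W))"
    by linarith
qed

text \<open>The vertex \<open>u\<close> covers both and loses 26, a surplus of 18 over 4 per edge: 2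
  * (55 + 5 * 4) + 18 = 168.\<close>

lemma sparse_two_isolated:
  assumes S: "sparse W" and u: "u \<in> V - W"
    and zz: "N u \<inter> W = {z, z'}" "z \<noteq> z'" "N z \<inter> W = {}" "N z' \<inter> W = {}"
  shows "\<exists>X. reducible sparse_wt W X \<and> closed_in W X"
proof -
  let ?X = "{z, z'}"
  have X: "closed_in W ?X" using zz unfolding closed_in_def by auto
  have eq: "N u \<inter> ?X = ?X" using zz by auto
  have "reducible sparse_wt W ?X"
  proof (rule reducible_sparse_wtI[OF S _ X, where A="{u}" and \<omega>="\<lambda>_. 4"
      and e="\<lambda>v. if v = u then 18 else 0"])
    show "covers {u} ?X" using u zz by (auto simp: covers_def)
    show "165 * int (card {u}) \<le> (\<Sum>x\<in>?X. 55 + 4 * (5 - int (wdeg W x)))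
        + (\<Sum>v\<in>V - W. if v = u then 18 else 0)"
      using zz u finV by simp
    fix v assume v: "v \<in> V - W"
    show "(\<Sum>x\<in>N v \<inter> ?X. 4) + (if v = u then 18 else 0) \<le> sparse_wt W v - sparse_wt (W - ?X) v"
      using S X v
    proof (cases rule: sparse_wt_drop_cases)
      case 0 then show ?thesis using eq by auto
    next
      case 1 then show ?thesis using eq zz by auto
    next
      case (isolated x) then show ?thesis using eq zz by auto
    next
      case (paired x) then show ?thesis using eq zz by auto
    qed (use eq in auto)
  qed auto
  then show ?thesis using X by blast
qed

text \<open>By the assumption on \<open>y\<close>, all four or more edges from \<open>y\<close> to
  blue vertices are worth 13, while those from \<open>x\<close> are worth at least 4: 55 + 4 * 13 +
  55 + 4 * 4 = 178.\<close>

lemma sparse_pair_side: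
  assumes S: "sparse W" and xy: "N x \<inter> W = {y}" "N y \<inter> W = {x}" "x \<noteq> y"
    and y: "\<And>u z. u \<in> N y - W \<Longrightarrow> z \<in> N u \<inter> W \<Longrightarrow> N z \<inter> W \<noteq> {}"
  shows "\<exists>X. reducible sparse_wt W X \<and> closed_in W X"
proof -
  let ?X = "{x, y}"
  have W: "W \<subseteq> V" using S unfolding sparse_def by auto
  have X: "closed_in W ?X" using xy unfolding closed_in_def by auto
  have "reducible sparse_wt W ?X"
  proof (rule reducible_sparse_wtI[OF S _ X, where A="{x}" and \<omega>="\<lambda>p. if p = y then 13 else 4"
      and e="\<lambda>_. 0"])
    show "covers {x} ?X" using xy W by (auto simp: covers_def)
    show "165 * int (card {x})
        \<le> (\<Sum>p\<in>?X. 55 + (if p = y then 13 else 4) * (5 - int (wdeg W p))) + (\<Sum>v\<in>V - W. 0)"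
      using xy by simp
    fix v assume v: "v \<in> V - W"
    have le: "(\<Sum>p\<in>N v \<inter> ?X. if p = y then 13 else 4) \<le> 13 * int (wdeg ?X v)"
    proof -
      have "(\<Sum>p\<in>N v \<inter> ?X. if p = y then 13 else 4) \<le> (\<Sum>p\<in>N v \<inter> ?X. 13::int)"
        by (rule sum_mono) simp
      then show ?thesis by simp
    qed
    show "(\<Sum>p\<in>N v \<inter> ?X. if p = y then 13 else 4) + 0 \<le> sparse_wt W v - sparse_wt (W - ?X) v"
      using S X v
    proof (cases rule: sparse_wt_drop_cases)
      case (isolated z)
      have "v \<notin> N y" using y[of v z] isolated v by auto
      then have "y \<notin> N v" using v N_sym by blast
      then have "(\<Sum>p\<in>N v \<inter> ?X. if p = y then 13 else 4) = (\<Sum>p\<in>N v \<inter> ?X. 4::int)"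
        by (intro sum.cong) auto
      then show ?thesis using isolated by simp
    qed (use le in auto)
  qed auto
  then show ?thesis using X by blast
qed

text \<open>If nothing is reducible, a blue vertex has at most one isolated white neighbour
  (\<open>iso\<close>). For a white edge, \<open>sparse_pair_side\<close> links both ends through
  blue vertices to isolated white vertices; these must all be the same vertex (\<open>sep\<close>),
  and it can be removed together with the edge.\<close>

lemma sparse_step:
  assumes S: "sparse W" and ne: "W \<noteq> {}"
  shows "\<exists>X. reducible sparse_wt W X \<and> closed_in W X"
proof (rule ccontr)
  assume nr: "\<not> ?thesis"
  have W: "W \<subseteq> V" using S unfolding sparse_def by auto
  have iso: "z = z'" if "u \<in> V - W" "z \<in> N u \<inter> W" "N z \<inter> W = {}" "z' \<in> N u \<inter> W" "N z' \<inter> W = {}"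
      for u z z'
  proof (rule ccontr)
    assume "z \<noteq> z'"
    moreover have "card (N u \<inter> W) \<le> 2" "finite (N u \<inter> W)"
      using that S finN unfolding sparse_def by auto
    ultimately have "N u \<inter> W = {z, z'}"
      using card_seteq[of "N u \<inter> W" "{z, z'}"] that by simp
    then show False using sparse_two_isolated[OF S that(1)] that \<open>z \<noteq> z'\<close> nr by blast
  qed
  show False
  proof (cases "\<forall>w\<in>W. N w \<inter> W = {}")
    case True
    obtain z where z: "z \<in> W" using ne by auto
    have X: "closed_in W {z}" using z True unfolding closed_in_def by auto
    \<comment> \<open>By \<open>iso\<close>, \<open>z\<close> is the only white neighbour of each of
      its blue neighbours, so each of them loses 22: 55 + 5 * 22 = 165.\<close>
    have "reducible sparse_wt W {z}"
    proof (rule reducible_sparse_wtI[OF S _ X, where A="{z}" and \<omega>="\<lambda>_. 22" and e="\<lambda>_. 0"])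
      show "covers {z} {z}" using z W by (auto simp: covers_def)
      show "165 * int (card {z}) \<le> (\<Sum>p\<in>{z}. 55 + 22 * (5 - int (wdeg W p))) + (\<Sum>v\<in>V - W. 0)"
        using True z by simp
      fix v assume v: "v \<in> V - W"
      show "(\<Sum>p\<in>N v \<inter> {z}. 22) + 0 \<le> sparse_wt W v - sparse_wt (W - {z}) v"
      proof (cases "z \<in> N v")
        case True
        have "q = z" if "q \<in> N v \<inter> W" for q
          using iso[OF v, of q z] \<open>\<forall>w\<in>W. N w \<inter> W = {}\<close> True z that by blast
        then have "N v \<inter> W = {z}" using True z by blast
        moreover from this have "N v \<inter> (W - {z}) = {}" "N v \<inter> {z} = {z}" by blast+
        ultimately show ?thesis using \<open>\<forall>w\<in>W. N w \<inter> W = {}\<close> z by (simp add: sparse_wt_def)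
      next
        case False
        show ?thesis using S X v by (cases rule: sparse_wt_drop_cases) (use False in auto)
      qed
    qed auto
    then show False using nr X by blast
  next
    case False
    then obtain x where x: "x \<in> W" "N x \<inter> W \<noteq> {}" by auto
    have "wdeg W x \<le> 1" using S x unfolding sparse_def by auto
    moreover have "finite (N x \<inter> W)" using x W finN by blast
    moreover obtain y where "y \<in> N x \<inter> W" using x by blast
    ultimately have y: "N x \<inter> W = {y}" using card_seteq[of "N x \<inter> W" "{y}"] by simp
    then have yW: "y \<in> W" and xy: "x \<noteq> y" and "x \<in> N y" using N_irrefl N_sym x W by blast+
    have "wdeg W y \<le> 1" using S yW unfolding sparse_def by auto
    then have yx: "N y \<inter> W = {x}"
      using card_seteq[of "N y \<inter> W" "{x}"] \<open>x \<in> N y\<close> x yW W finN by auto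
    have "\<exists>u\<in>N y - W. \<exists>z\<in>N u \<inter> W. N z \<inter> W = {}"
      using sparse_pair_side[OF S y yx xy] nr by blast
    then obtain u' z' where u': "u' \<in> N y - W" "z' \<in> N u' \<inter> W" "N z' \<inter> W = {}" by blast
    have "\<exists>u\<in>N x - W. \<exists>z\<in>N u \<inter> W. N z \<inter> W = {}"
      using sparse_pair_side[OF S yx y xy[symmetric]] nr by blast
    then obtain u z where u: "u \<in> N x - W" "z \<in> N u \<inter> W" "N z \<inter> W = {}" by blast
    have V: "x \<in> V" "y \<in> V" "z \<in> V" "z' \<in> V" using x yW u u' W by auto
    have ne: "z \<noteq> x" "z \<noteq> y" "z' \<noteq> x" "z' \<noteq> y" using u u' y yx by auto
    \<comment> \<open>Otherwise \<open>u\<close> and \<open>u'\<close> cover four vertices. Only the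
      edges at \<open>z\<close> and \<open>z'\<close> are charged; by \<open>iso\<close> no other
      isolated white vertex remains at their blue ends: 4 * 55 + 2 * 5 * 13 = 350.\<close>
    have sep: "z = z'" if u: "u \<in> N x - W" "z \<in> N u \<inter> W" "N z \<inter> W = {}"
      and u': "u' \<in> N y - W" "z' \<in> N u' \<inter> W" "N z' \<inter> W = {}" for u z u' z'
    proof (rule ccontr)
      assume zz: "z \<noteq> z'"
      have uV: "u \<in> V - W" "u' \<in> V - W" using u u' N_sub[OF V(1)] N_sub[OF V(2)] by auto
      have xu: "x \<in> N u" "y \<in> N u'" using u u' V N_sym by blast+
      have ne: "z \<noteq> x" "z \<noteq> y" "z' \<noteq> x" "z' \<noteq> y" using u u' y yx by auto
      let ?X = "{x, y, z, z'}"
      have X: "closed_in W ?X" using y yx u u' x yW unfolding closed_in_def by auto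
      have "reducible sparse_wt W ?X"
      proof (rule reducible_sparse_wtI[OF S _ X, where A="{u, u'}"
          and \<omega>="\<lambda>p. if p \<in> {z, z'} then 13 else 0" and e="\<lambda>_. 0"])
        show "covers {u, u'} ?X" using xu u u' uV by (auto simp: covers_def)
        have "card {u, u'} \<le> 2" by (simp add: card_insert_if)
        then show "165 * int (card {u, u'})
            \<le> (\<Sum>p\<in>?X. 55 + (if p \<in> {z, z'} then 13 else 0) * (5 - int (wdeg W p))) + (\<Sum>v\<in>V - W. 0)"
          using zz ne xy u u' by simp
        fix v assume v: "v \<in> V - W"
        have le: "(\<Sum>p\<in>N v \<inter> ?X. if p \<in> {z, z'} then 13 else 0) \<le> 13 * int (wdeg ?X v)"
        proof -
          have "(\<Sum>p\<in>N v \<inter> ?X. if p \<in> {z, z'} then 13 else 0) \<le> (\<Sum>p\<in>N v \<inter> ?X. 13::int)"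
            by (rule sum_mono) simp
          then show ?thesis by simp
        qed
        show "(\<Sum>p\<in>N v \<inter> ?X. if p \<in> {z, z'} then 13 else 0) + 0
            \<le> sparse_wt W v - sparse_wt (W - ?X) v"
          using S X v
        proof (cases rule: sparse_wt_drop_cases)
          case (isolated q)
          have "z \<notin> N v" "z' \<notin> N v" using iso[OF v] isolated u u' by blast+
          then have "(\<Sum>p\<in>N v \<inter> ?X. if p \<in> {z, z'} then 13 else 0) = (\<Sum>p\<in>N v \<inter> ?X. 0::int)"
            by (intro sum.cong) auto
          then show ?thesis using isolated by simp
        qed (use le in auto)
      qed auto
      then show False using nr X by blast
    qed
    have "z' = z" using sep[OF u u'] by simp
    \<comment> \<open>By \<open>sep\<close> and \<open>iso\<close>, no blue neighbour of these three
      keeps an isolated white neighbour, so every edge is worth 13: 3 * 55 + (4 + 4 + 5) * 13 =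
      334.\<close>
    let ?X = "{x, y, z}"
    have X: "closed_in W ?X" using y yx u x yW unfolding closed_in_def by auto
    have "reducible sparse_wt W ?X"
    proof (rule reducible_sparse_wtI[OF S _ X, where A="{x, z}" and \<omega>="\<lambda>_. 13" and e="\<lambda>_. 0"])
      show "covers {x, z} ?X" using V y by (auto simp: covers_def)
      show "165 * int (card {x, z}) \<le> (\<Sum>p\<in>?X. 55 + 13 * (5 - int (wdeg W p))) + (\<Sum>v\<in>V - W. 0)"
        using ne xy u y yx by simp
      fix v assume v: "v \<in> V - W"
      show "(\<Sum>p\<in>N v \<inter> ?X. 13) + 0 \<le> sparse_wt W v - sparse_wt (W - ?X) v"
        using S X v
      proof (cases rule: sparse_wt_drop_cases)
        case (isolated q)
        then have q: "q \<in> N v \<inter> W" "N q \<inter> W = {}" "q \<noteq> z" by auto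
        have "z \<notin> N v" using iso[OF v q(1,2)] u q(3) by blast
        moreover have "x \<notin> N v"
        proof
          assume "x \<in> N v"
          then have "v \<in> N x - W" using v N_sym by blast
          then show False using sep[OF _ q(1,2) u'] q \<open>z' = z\<close> by blast
        qed
        moreover have "y \<notin> N v"
        proof
          assume "y \<in> N v"
          then have "v \<in> N y - W" using v N_sym by blast
          then show False using sep[OF u _ q(1,2)] q by blast
        qed
        ultimately have "N v \<inter> ?X = {}" by auto
        then show ?thesis using isolated by simp
      qed auto
    qed auto
    then show False using nr X by blast
  qed
qed

section \<open>Induction on the white set\<close>

lemma covers_Un: "covers A X \<Longrightarrow> covers B Y \<Longrightarrow> covers (A \<union> B) (X \<union> Y)"
  unfolding covers_def by blast

lemma covers_reducible:
  assumes W: "W \<subseteq> V" and red: "reducible c W X"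
      and D: "covers D (W - X)" "165 * int (card D) \<le> potential c (W - X)"
  shows "\<exists>D. covers D W \<and> 165 * int (card D) \<le> potential c W"
proof -
  obtain A where A: "X \<subseteq> W" "covers A X" "165 * int (card A) \<le> potential c W - potential c (W - X)"
    using red unfolding reducible_def by auto
  have "covers (A \<union> D) W" using covers_Un[OF A(2) D(1)] A(1) by (simp add: Un_absorb1)
  moreover have "165 * int (card (A \<union> D)) \<le> potential c W"
    using A(3) D(2) card_Un_le[of A D] by linarith
  ultimately show ?thesis by blast
qed

lemma reducible_psubset: "reducible c W X \<Longrightarrow> W - X \<subset> W"
  unfolding reducible_def by auto

lemma sparse_cover_potential:
  assumes "sparse W" shows "\<exists>D. covers D W \<and> 165 * int (card D) \<le> potential sparse_wt W"
proof -
  have "finite W" using assms finV finite_subset unfolding sparse_def by auto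
  then show ?thesis using assms
  proof (induction W rule: finite_psubset_induct)
    case (psubset W)
    show ?case
    proof (cases "W = {}")
      case True
      then have "covers {} W" "0 \<le> potential sparse_wt W"
        by (auto simp: covers_def potential_def sparse_wt_def blue_weight_nonneg intro!: sum_nonneg)
      then show ?thesis by force
    next
      case False
      then obtain X where X: "reducible sparse_wt W X" "closed_in W X"
        using sparse_step psubset.prems by blast
      then obtain D where "covers D (W - X)" "165 * int (card D) \<le> potential sparse_wt (W - X)"
        using psubset.IH[OF reducible_psubset[OF X(1)]] sparse_diff[OF psubset.prems X(2)] by blast
      then show ?thesis using covers_reducible[OF _ X(1)] psubset.prems unfolding sparse_def
        by blast
    qed
  qed
qed

text \<open>When no set is reducible for \<open>wt\<close>, the white set is sparse. Changing to
  \<open>sparse_wt\<close> then costs nothing, since it only lowers some weights from 22 to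
  13.\<close>

lemma cover_potential:
  assumes "W \<subseteq> V" shows "\<exists>D. covers D W \<and> 165 * int (card D) \<le> potential wt W"
proof -
  have "finite W" using assms finV finite_subset by auto
  then show ?thesis using assms
  proof (induction W rule: finite_psubset_induct)
    case (psubset W)
    show ?case
    proof (cases "\<exists>X. reducible wt W X")
      case True
      then obtain X where X: "reducible wt W X" by blast
      then obtain D where "covers D (W - X)" "165 * int (card D) \<le> potential wt (W - X)"
        using psubset.IH[OF reducible_psubset[OF X]] psubset.prems by blast
      then show ?thesis using covers_reducible[OF psubset.prems X] by blast
    next
      case False
      then have "sparse W" using reducible_or_sparse[OF psubset.prems] psubset.prems
        unfolding sparse_def by blast
      moreover have "potential sparse_wt W \<le> potential wt W"
      proof -
        have "13 \<le> blue_weight 1" by simp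
        then have "sparse_wt W u \<le> wt W u" for u
          unfolding sparse_wt_def wt_def by (split if_split) (metis order_refl)
        then show ?thesis unfolding potential_def by (intro add_left_mono sum_mono)
      qed
      ultimately show ?thesis using sparse_cover_potential by force
    qed
  qed
qed

text \<open>With every vertex white there are no blue weights, and 165 = 3 * 55.\<close>

lemma dominating_third: "\<exists>D. covers D V \<and> 3 * card D \<le> card V"
proof -
  have "potential wt V = 55 * int (card V)" by (simp add: potential_def)
  then show ?thesis using cover_potential[of V] by auto
qed

end

section \<open>Transfer to \<open>pair_graph\<close> by out-neighbourhoods\<close>

theorem theorem1:
  fixes G :: "'a pair_pre_digraph" and n :: nat
  assumes "pair_graph G"
    and "card (pverts G) = n"
    and "min_degree G = 5"
  shows "real (domination_number G) \<le> real n / 3"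
proof -
  interpret pair_graph G by fact
  let ?N = "\<lambda>v. {u. (v, u) \<in> parcs G}"
  have "min_degree_five (pverts G) ?N"
  proof
    show "finite (pverts G)" by (rule pair_finite_verts)
    show "?N v \<subseteq> pverts G" for v using in_arcsD2 by blast
    show "v \<in> ?N u" if "u \<in> ?N v" for u v
      using that pair_sym_arcs by (auto simp: symmetric_def dest: symD)
    show "v \<notin> ?N v" for v using no_loops' by auto
    fix v assume v: "v \<in> pverts G"
    have "5 \<le> out_degree G v"
      using assms(3) v pair_finite_verts unfolding min_degree_def
      by (metis Min_le finite_imageI imageI)
    also have "out_arcs G v = Pair v ` ?N v" by (auto simp: out_arcs_def)
    then have "out_degree G v = card (?N v)"
      unfolding out_degree_def by (simp add: card_image inj_on_def)
    finally show "5 \<le> card (?N v)" .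
  qed
  then obtain D where D: "min_degree_five.covers (pverts G) ?N D (pverts G)" "3 * card D \<le> n"
    using min_degree_five.dominating_third assms(2) by blast
  then have "dominating_set G D"
    unfolding min_degree_five.covers_def[OF \<open>min_degree_five _ _\<close>] dominating_set_def by blast
  then have "domination_number G \<le> card D"
    unfolding domination_number_def by (intro Min_le finite_dominating_set_cards) blast
  then have "3 * domination_number G \<le> n" using D(2) by linarith
  then show ?thesis by linarith
qed

end
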